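(* Let $n\in\mathbb{N}$, $H\in\mathbb{R}^{n\times n}$, $W\in\mathbb{R}^{n\times n}$ with $W\succ 0$, let $C=\mathrm{diag}(C_{11},\dots,C_{nn})$ be diagonal with all $C_{ii}\neq 0$, and let $V=\mathrm{diag}(\sigma_1^2,\dots,\sigma_n^2)$ with all $\sigma_i>0$. Assume $(H,C)$ is observable and $(H,D)$ is controllable, where $W=DD^T$. Let $\Sigma$ be the unique positive semidefinite solution of the discrete algebraic Riccati equation $$\Sigma = H\Sigma H^T - H\Sigma C^T(C\Sigma C^T+V)^{-1}C\Sigma H^T + W .$$ Then $$\mathrm{tr}\,W+\frac{\sigma_u^2\,\mathrm{tr}(H^TH)\,\lambda_n(W)}{\sigma_u^2+\lambda_n(W)C_u^2}\;\le\;\mathrm{tr}\,\Sigma\;\le\;\mathrm{tr}\,W+\frac{\sigma_l^2\,\mathrm{tr}(H^TH)}{C_l^2}.$$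
   Context: This models a linear system $x(k+1)=Hx(k)+w(k)$, $w(k)\sim\mathcal N(0,W)$, whose outputs $Cx(k)$ are privatized by adding Gaussian noise $v(k)\sim\mathcal N(0,V)$ before being processed by a steady-state Kalman filter; $\Sigma$ is the steady-state a priori error covariance, and $\mathrm{tr}\,\Sigma$ equals the steady-state mean squared prediction error. For a symmetric matrix $K$, $\lambda_n(K)\le\dots\le\lambda_1(K)$ denote its eigenvalues. Indices: $l:=\arg\min_{1\le i\le n} C_{ii}^2/\sigma_i^2$ and $u:=\arg\max_{1\le i\le n} C_{ii}^2/\sigma_i^2$; $C_l:=C_{ll}$, $C_u:=C_{uu}$, and $\sigma_l,\sigma_u$ are the corresponding $\sigma_i$. Thus $\lambda_n(C^TV^{-1}C)=C_l^2/\sigma_l^2$ and $\lambda_1(C^TV^{-1}C)=C_u^2/\sigma_u^2$. *)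

theory Defs
  imports "HOL-Analysis.Analysis"
begin

definition diag_mat :: "real^'n^'n \<Rightarrow> bool" where
  "diag_mat A \<longleftrightarrow> (\<forall>i j. i \<noteq> j \<longrightarrow> A$i$j = 0)"

definition sym_mat :: "real^'n^'n \<Rightarrow> bool" where
  "sym_mat A \<longleftrightarrow> transpose A = A"

definition pos_def :: "real^'n^'n \<Rightarrow> bool" where
  "pos_def A \<longleftrightarrow> sym_mat A \<and> (\<forall>x. x \<noteq> 0 \<longrightarrow> x \<bullet> (A *v x) > 0)"

definition pos_semidef :: "real^'n^'n \<Rightarrow> bool" where
  "pos_semidef A \<longleftrightarrow> sym_mat A \<and> (\<forall>x. x \<bullet> (A *v x) \<ge> 0)"

text \<open>Smallest (real) eigenvalue lambda_n of a symmetric matrix.\<close>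
definition lambda_min :: "real^'n^'n \<Rightarrow> real" where
  "lambda_min A = Min {e. \<exists>v. v \<noteq> 0 \<and> A *v v = e *\<^sub>R v}"

text \<open>(H,C) observable: the observability matrix [C; CH; ...; CH^(n-1)] has full
  column rank n, i.e. trivial kernel.\<close>
definition observable :: "real^'n^'n \<Rightarrow> real^'n^'p \<Rightarrow> bool" where
  "observable H C \<longleftrightarrow>
     (\<forall>x. (\<forall>k < CARD('n). C *v (((*v) H ^^ k) x) = 0) \<longrightarrow> x = 0)"

text \<open>(H,D) controllable: the controllability matrix [D, HD, ..., H^(n-1) D] has full
  row rank n, i.e. its transpose has trivial kernel.\<close>
definition controllable :: "real^'n^'n \<Rightarrow> real^'m^'n \<Rightarrow> bool" where
  "controllable H D \<longleftrightarrow>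
     (\<forall>y. (\<forall>k < CARD('n). transpose D *v (((*v) (transpose H) ^^ k) y) = 0) \<longrightarrow> y = 0)"

end

theory Submission
  imports Defs
begin

text \<open>
  With the a posteriori covariance \<open>P = \<Sigma> - \<Sigma>C\<^sup>T(C\<Sigma>C\<^sup>T + V)\<^sup>-\<^sup>1C\<Sigma>\<close> the Riccati
  equation reads \<open>\<Sigma> = HPH\<^sup>T + W\<close>, so \<open>tr \<Sigma> = tr W + tr (HPH\<^sup>T)\<close> and it suffices to squeeze
  the quadratic form of \<open>P\<close> between multiples of \<open>x \<bullet> x\<close>. The Joseph form
  \<open>x\<^sup>TPx = e\<^sup>T\<Sigma>e + w\<^sup>TVw\<close> with \<open>x = e + C\<^sup>Tw\<close> shows \<open>P \<ge> 0\<close>, hence \<open>\<Sigma> \<ge> \<lambda>\<^sub>n(W)\<close>, and then a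
  coordinatewise Cauchy-Schwarz estimate gives the lower bound. For the upper bound, \<open>x\<^sup>TPx\<close> is
  the minimum over \<open>w\<close> of this Joseph form, so the choice \<open>e = 0\<close>, \<open>w = C\<^sup>-\<^sup>Tx\<close> bounds it by
  \<open>\<Sum>\<^sub>i \<sigma>\<^sub>i\<^sup>2 x\<^sub>i\<^sup>2 / C\<^sub>i\<^sub>i\<^sup>2\<close>. Observability and controllability only serve to make \<open>\<Sigma>\<close> unique;
  the bounds hold for every positive semidefinite solution.
\<close>

lemma matrix_diff_ldistrib: "(A::real^'n^'m) ** (B - C) = A ** B - A ** C"
  by (simp add: vec_eq_iff matrix_matrix_mult_def algebra_simps sum_subtractf)

lemma matrix_diff_rdistrib: "((A::real^'n^'m) - B) ** C = A ** C - B ** C"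
  by (simp add: vec_eq_iff matrix_matrix_mult_def algebra_simps sum_subtractf)

lemma matrix_inv_right: "invertible (A::real^'n^'n) \<Longrightarrow> A ** matrix_inv A = mat 1"
  unfolding invertible_def matrix_inv_def by (rule someI_ex[THEN conjunct1])

lemma matrix_inv_right_vec: "invertible (A::real^'n^'n) \<Longrightarrow> A *v (matrix_inv A *v y) = y"
  by (simp add: matrix_vector_mul_assoc matrix_inv_right)

lemma inner_transpose_left: "(x::real^'m) \<bullet> ((A::real^'n^'m) *v y) = (transpose A *v x) \<bullet> y"
  by (simp add: dot_lmul_matrix)

lemma sym_mat_inner_commute: "sym_mat A \<Longrightarrow> (x::real^'n) \<bullet> ((A::real^'n^'n) *v y) = (A *v x) \<bullet> y"
  by (metis inner_transpose_left sym_mat_def)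

lemma sym_mat_add: "sym_mat A \<Longrightarrow> sym_mat B \<Longrightarrow> sym_mat ((A::real^'n^'n) + B)"
  by (simp add: sym_mat_def transpose_def vec_eq_iff)

lemma sym_mat_congruence: "sym_mat B \<Longrightarrow> sym_mat ((A::real^'n^'m) ** B ** transpose A)"
  by (simp add: sym_mat_def matrix_transpose_mul matrix_mul_assoc)

lemma inner_congruence:
  "(x::real^'m) \<bullet> (((A::real^'n^'m) ** B ** transpose A) *v x) = (transpose A *v x) \<bullet> (B *v (transpose A *v x))"
  by (simp only: matrix_vector_mul_assoc[symmetric] inner_transpose_left)

lemma diag_mat_mult_vec: "diag_mat C \<Longrightarrow> ((C::real^'n^'n) *v x) $ i = C$i$i * x$i"
proof -
  assume "diag_mat C"
  then have "(\<Sum>j\<in>UNIV. C$i$j * x$j) = (\<Sum>j\<in>UNIV. if j = i then C$i$i * x$i else 0)"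
    by (intro sum.cong) (auto simp: diag_mat_def)
  then show ?thesis by (simp add: matrix_vector_mult_def)
qed

lemma diag_mat_transpose: "diag_mat C \<Longrightarrow> transpose (C::real^'n^'n) = C"
  by (auto simp: diag_mat_def transpose_def vec_eq_iff) (metis)

lemma inner_diag_mat: "diag_mat V \<Longrightarrow> (x::real^'n) \<bullet> (V *v x) = (\<Sum>i\<in>UNIV. V$i$i * (x$i)^2)"
  by (simp add: inner_vec_def diag_mat_mult_vec power2_eq_square mult_ac)

lemma pos_def_diag_mat:
  assumes "diag_mat V" "\<forall>i. 0 < V$i$i"
  shows "pos_def (V::real^'n^'n)"
  unfolding pos_def_def sym_mat_def
proof (intro conjI allI impI)
  show "transpose V = V" using assms(1) by (rule diag_mat_transpose)
  fix x :: "real^'n" assume "x \<noteq> 0"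
  then obtain i where "x$i \<noteq> 0" by (auto simp: vec_eq_iff)
  then show "0 < x \<bullet> (V *v x)"
    using assms by (auto simp: inner_diag_mat less_imp_le intro!: sum_pos2[where i=i])
qed

lemma finite_eigenvalues_sym_mat:
  assumes "sym_mat (W::real^'n^'n)"
  shows "finite {e. \<exists>v. v \<noteq> 0 \<and> W *v v = e *\<^sub>R v}"
proof -
  define S where "S = {e. \<exists>v. v \<noteq> 0 \<and> W *v v = e *\<^sub>R v}"
  define g where "g e = (SOME v. v \<noteq> 0 \<and> W *v v = e *\<^sub>R v)" for e
  have g: "g e \<noteq> 0 \<and> W *v g e = e *\<^sub>R g e" if "e \<in> S" for e
  proof -
    have "\<exists>v. v \<noteq> 0 \<and> W *v v = e *\<^sub>R v" using that by (simp add: S_def)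
    then show ?thesis unfolding g_def by (rule someI_ex)
  qed
  have orth: "g e1 \<bullet> g e2 = 0" if "e1 \<in> S" "e2 \<in> S" "e1 \<noteq> e2" for e1 e2
  proof -
    have "e2 * (g e1 \<bullet> g e2) = e1 * (g e1 \<bullet> g e2)"
      using sym_mat_inner_commute[OF assms, of "g e1" "g e2"] g[OF that(1)] g[OF that(2)] by simp
    then show ?thesis using that(3) by simp
  qed
  have inj: "inj_on g S"
  proof (rule inj_onI)
    fix e1 e2 assume "e1 \<in> S" "e2 \<in> S" "g e1 = g e2"
    then have "e1 *\<^sub>R g e1 = e2 *\<^sub>R g e1" using g by metis
    then show "e1 = e2" using g \<open>e1 \<in> S\<close> by (simp add: scaleR_cancel_right)
  qed
  have "pairwise orthogonal (g ` S)"
    using orth by (auto simp: pairwise_def orthogonal_def simp del: mem_Collect_eq)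
  moreover have "0 \<notin> g ` S" using g by (metis imageE)
  ultimately have "finite (g ` S)"
    by (intro independent_imp_finite pairwise_orthogonal_independent)
  then show ?thesis using inj finite_imageD S_def by blast
qed

lemma linear_coeff_zero_if_quadratic_nonneg:
  fixes a b :: real
  assumes "\<forall>t. 0 \<le> a * t + b * t^2"
  shows "a = 0"
proof (rule ccontr)
  assume "a \<noteq> 0"
  define B where "B = \<bar>b\<bar> + 1"
  have "B > 0" "b < B" by (auto simp: B_def)
  have "a * (- a / B) + b * (- a / B)^2 = a^2 * (b - B) / B^2"
    using \<open>B > 0\<close> by (simp add: field_simps power2_eq_square)
  also have "\<dots> < 0"
    using \<open>a \<noteq> 0\<close> \<open>b < B\<close> \<open>B > 0\<close> by (simp add: divide_neg_pos mult_pos_neg)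
  finally show False using assms by (metis not_le)
qed

lemma sym_mat_eigenvector_if_min_quadratic:
  assumes W: "sym_mat (W::real^'n^'n)"
    and ge: "\<forall>x. \<mu> * (x \<bullet> x) \<le> x \<bullet> (W *v x)"
    and eq: "x0 \<bullet> (W *v x0) = \<mu> * (x0 \<bullet> x0)"
  shows "W *v x0 = \<mu> *\<^sub>R x0"
proof -
  define q where "q x = x \<bullet> (W *v x) - \<mu> * (x \<bullet> x)" for x
  define r where "r = W *v x0 - \<mu> *\<^sub>R x0"
  have "q (x0 + t *\<^sub>R r) = 2 * (r \<bullet> r) * t + q r * t^2" for t
  proof -
    have "x0 \<bullet> (W *v r) = r \<bullet> (W *v x0)"
      using sym_mat_inner_commute[OF W, of x0 r] by (simp add: inner_commute)
    then show ?thesis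
      using eq unfolding q_def r_def
      by (simp add: matrix_vector_right_distrib matrix_vector_mult_scaleR inner_add_left
          inner_add_right inner_diff_left inner_diff_right inner_commute power2_eq_square algebra_simps)
  qed
  moreover have "0 \<le> q x" for x using ge by (simp add: q_def)
  ultimately have "2 * (r \<bullet> r) = 0"
    using linear_coeff_zero_if_quadratic_nonneg[of "2 * (r \<bullet> r)" "q r"] by metis
  then show ?thesis by (simp add: r_def)
qed

lemma sym_mat_min_eigenvalue:
  assumes "sym_mat (W::real^'n^'n)"
  obtains \<mu> v where "v \<noteq> 0" "W *v v = \<mu> *\<^sub>R v" "\<forall>x. \<mu> * (x \<bullet> x) \<le> x \<bullet> (W *v x)"
proof -
  define f where "f x = x \<bullet> (W *v x)" for x :: "real^'n"
  have "continuous_on (sphere 0 1) f"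
    unfolding f_def by (intro continuous_intros linear_continuous_on matrix_vector_mul_linear)
  moreover have "sphere (0::real^'n) 1 \<noteq> {}" by (simp add: sphere_eq_empty)
  ultimately obtain v where v: "v \<in> sphere 0 1" and min: "\<forall>y\<in>sphere 0 1. f v \<le> f y"
    using continuous_attains_inf[OF compact_sphere] by blast
  have vv: "v \<bullet> v = 1" using v by (simp add: dot_square_norm)
  have ge: "f v * (x \<bullet> x) \<le> f x" for x
  proof (cases "x = 0")
    case False
    have "f v \<le> f ((1 / norm x) *\<^sub>R x)" using min False by simp
    also have "\<dots> = f x / (x \<bullet> x)"
      by (simp add: f_def matrix_vector_mult_scaleR dot_square_norm power2_eq_square)
    finally show ?thesis using False by (simp add: field_simps)
  qed (simp add: f_def)
  have "W *v v = f v *\<^sub>R v"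
    using assms ge vv by (intro sym_mat_eigenvector_if_min_quadratic) (auto simp: f_def)
  moreover have "v \<noteq> 0" using vv by auto
  ultimately show ?thesis using that ge unfolding f_def by blast
qed

lemma lambda_min_le_quadratic:
  assumes "sym_mat (W::real^'n^'n)"
  shows "lambda_min W * (x \<bullet> x) \<le> x \<bullet> (W *v x)"
proof -
  obtain \<mu> v where "v \<noteq> 0" "W *v v = \<mu> *\<^sub>R v" and ge: "\<forall>x. \<mu> * (x \<bullet> x) \<le> x \<bullet> (W *v x)"
    using sym_mat_min_eigenvalue[OF assms] .
  then have "lambda_min W \<le> \<mu>"
    unfolding lambda_min_def using finite_eigenvalues_sym_mat[OF assms] by (auto intro!: Min_le)
  then show ?thesis using ge mult_right_mono[of _ \<mu> "x \<bullet> x"] by (meson inner_ge_zero order_trans)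
qed

lemma lambda_min_pos:
  assumes "pos_def (W::real^'n^'n)"
  shows "0 < lambda_min W"
proof -
  have W: "sym_mat W" using assms by (simp add: pos_def_def)
  obtain \<mu> v where v: "v \<noteq> 0" "W *v v = \<mu> *\<^sub>R v"
    using sym_mat_min_eigenvalue[OF W] by blast
  then have "lambda_min W \<in> {e. \<exists>v. v \<noteq> 0 \<and> W *v v = e *\<^sub>R v}"
    unfolding lambda_min_def using finite_eigenvalues_sym_mat[OF W] by (intro Min_in) auto
  then obtain w where "w \<noteq> 0" "W *v w = lambda_min W *\<^sub>R w" by blast
  moreover have "0 < w \<bullet> (W *v w)" using assms \<open>w \<noteq> 0\<close> by (simp add: pos_def_def)
  moreover have "0 < w \<bullet> w" using \<open>w \<noteq> 0\<close> by simp
  ultimately show ?thesis by (simp add: zero_less_mult_iff)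
qed

lemma pos_def_quadratic_nonneg: "pos_def A \<Longrightarrow> 0 \<le> (x::real^'n) \<bullet> (A *v x)"
  by (cases "x = 0") (auto simp: pos_def_def less_imp_le)

lemma invertible_innovation_cov:
  fixes \<Sigma> :: "real^'n^'n" and C :: "real^'n^'p" and V :: "real^'p^'p"
  assumes "pos_semidef \<Sigma>" "pos_def V"
  shows "invertible (C ** \<Sigma> ** transpose C + V)"
proof -
  have "y = 0" if "(C ** \<Sigma> ** transpose C + V) *v y = 0" for y
  proof (rule ccontr)
    assume "y \<noteq> 0"
    then have "0 < y \<bullet> ((C ** \<Sigma> ** transpose C + V) *v y)"
      using assms by (simp add: matrix_vector_mult_add_rdistrib inner_add_right inner_congruence
          pos_def_def pos_semidef_def add_nonneg_pos)
    with that show False by simp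
  qed
  then show ?thesis by (simp add: invertible_left_inverse matrix_left_invertible_ker)
qed

definition posterior_cov :: "real^'n^'n \<Rightarrow> real^'n^'p \<Rightarrow> real^'p^'p \<Rightarrow> real^'n^'n" where
  "posterior_cov \<Sigma> C V = \<Sigma> - \<Sigma> ** transpose C ** matrix_inv (C ** \<Sigma> ** transpose C + V) ** C ** \<Sigma>"

lemma riccati_rhs_eq_posterior_cov:
  "H ** \<Sigma> ** transpose H
     - H ** \<Sigma> ** transpose C ** matrix_inv (C ** \<Sigma> ** transpose C + V) ** C ** \<Sigma> ** transpose H
   = H ** posterior_cov \<Sigma> C V ** transpose H"
  by (simp add: posterior_cov_def matrix_diff_ldistrib matrix_diff_rdistrib matrix_mul_assoc)

lemma posterior_cov_quadratic_form:
  fixes \<Sigma> :: "real^'n^'n" and C :: "real^'n^'p" and V :: "real^'p^'p" and x :: "real^'n"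
  assumes \<Sigma>: "sym_mat \<Sigma>" and M: "invertible (C ** \<Sigma> ** transpose C + V)"
  defines "w \<equiv> matrix_inv (C ** \<Sigma> ** transpose C + V) *v (C *v (\<Sigma> *v x))"
  shows "x \<bullet> (posterior_cov \<Sigma> C V *v x) = x \<bullet> (\<Sigma> *v x) - w \<bullet> ((C ** \<Sigma> ** transpose C + V) *v w)"
proof -
  have Mw: "(C ** \<Sigma> ** transpose C + V) *v w = C *v (\<Sigma> *v x)"
    unfolding w_def using M by (rule matrix_inv_right_vec)
  have "posterior_cov \<Sigma> C V *v x = \<Sigma> *v x - \<Sigma> *v (transpose C *v w)"
    by (simp add: posterior_cov_def w_def matrix_vector_mult_diff_rdistrib matrix_vector_mul_assoc
        matrix_mul_assoc)
  moreover have "x \<bullet> (\<Sigma> *v (transpose C *v w)) = (C *v (\<Sigma> *v x)) \<bullet> w"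
    using sym_mat_inner_commute[OF \<Sigma>] inner_transpose_left[of "\<Sigma> *v x" "transpose C" w] by simp
  ultimately show ?thesis by (simp add: inner_diff_right Mw inner_commute)
qed

lemma posterior_cov_joseph_form:
  fixes \<Sigma> :: "real^'n^'n" and C :: "real^'n^'p" and V :: "real^'p^'p" and x :: "real^'n"
  assumes \<Sigma>: "sym_mat \<Sigma>" and M: "invertible (C ** \<Sigma> ** transpose C + V)"
  defines "w \<equiv> matrix_inv (C ** \<Sigma> ** transpose C + V) *v (C *v (\<Sigma> *v x))"
  shows "x \<bullet> (posterior_cov \<Sigma> C V *v x)
           = (x - transpose C *v w) \<bullet> (\<Sigma> *v (x - transpose C *v w)) + w \<bullet> (V *v w)"
proof -
  define Cw where "Cw = transpose C *v w"
  have Mw: "(C ** \<Sigma> ** transpose C + V) *v w = C *v (\<Sigma> *v x)"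
    unfolding w_def using M by (rule matrix_inv_right_vec)
  have "w \<bullet> ((C ** \<Sigma> ** transpose C + V) *v w) = Cw \<bullet> (\<Sigma> *v Cw) + w \<bullet> (V *v w)"
    by (simp add: matrix_vector_mult_add_rdistrib inner_add_right inner_congruence Cw_def)
  moreover have "w \<bullet> ((C ** \<Sigma> ** transpose C + V) *v w) = Cw \<bullet> (\<Sigma> *v x)"
    unfolding Mw Cw_def by (simp add: inner_transpose_left)
  moreover have "x \<bullet> (\<Sigma> *v Cw) = Cw \<bullet> (\<Sigma> *v x)"
    using sym_mat_inner_commute[OF \<Sigma>] by (simp add: inner_commute)
  ultimately show ?thesis
    using posterior_cov_quadratic_form[OF \<Sigma> M, of x] unfolding w_def[symmetric] Cw_def[symmetric]
    by (simp add: matrix_vector_mult_diff_distrib inner_diff_left inner_diff_right inner_commute)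
qed

lemma posterior_cov_quadratic_nonneg:
  fixes \<Sigma> :: "real^'n^'n" and C :: "real^'n^'p" and V :: "real^'p^'p"
  assumes "pos_semidef \<Sigma>" "pos_def V"
  shows "0 \<le> x \<bullet> (posterior_cov \<Sigma> C V *v x)"
proof -
  have "sym_mat \<Sigma>" using assms(1) by (simp add: pos_semidef_def)
  moreover have "invertible (C ** \<Sigma> ** transpose C + V)"
    using assms by (rule invertible_innovation_cov)
  ultimately show ?thesis
    using assms by (simp add: posterior_cov_joseph_form pos_semidef_def pos_def_quadratic_nonneg
        add_nonneg_nonneg del: transpose_matrix_vector)
qed

lemma posterior_cov_quadratic_le:
  fixes \<Sigma> :: "real^'n^'n" and C :: "real^'n^'p" and V :: "real^'p^'p"
  assumes \<Sigma>: "pos_semidef \<Sigma>" and V: "pos_def V" and y: "transpose C *v y = x"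
  shows "x \<bullet> (posterior_cov \<Sigma> C V *v x) \<le> y \<bullet> (V *v y)"
proof -
  define M where "M = C ** \<Sigma> ** transpose C + V"
  define w where "w = matrix_inv M *v (C *v (\<Sigma> *v x))"
  have M: "invertible M" using invertible_innovation_cov[OF \<Sigma> V] by (simp add: M_def)
  have sym\<Sigma>: "sym_mat \<Sigma>" and symV: "sym_mat V" using \<Sigma> V by (simp_all add: pos_semidef_def pos_def_def)
  have symM: "sym_mat M" unfolding M_def by (intro sym_mat_add sym_mat_congruence sym\<Sigma> symV)
  have Mw: "M *v w = C *v (\<Sigma> *v x)"
    unfolding w_def using M by (rule matrix_inv_right_vec)
  have quad: "z \<bullet> (M *v z) = (transpose C *v z) \<bullet> (\<Sigma> *v (transpose C *v z)) + z \<bullet> (V *v z)" for z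
    by (simp add: M_def matrix_vector_mult_add_rdistrib inner_add_right inner_congruence)
  have "0 \<le> (y - w) \<bullet> (M *v (y - w))"
    using \<Sigma> V unfolding quad
    by (simp add: pos_semidef_def pos_def_quadratic_nonneg add_nonneg_nonneg del: transpose_matrix_vector)
  also have "\<dots> = y \<bullet> (M *v y) - 2 * (y \<bullet> (M *v w)) + w \<bullet> (M *v w)"
    using sym_mat_inner_commute[OF symM, of w y]
    by (simp add: matrix_vector_mult_diff_distrib inner_diff_left inner_diff_right
        inner_commute)
  also have "y \<bullet> (M *v w) = x \<bullet> (\<Sigma> *v x)"
    unfolding Mw inner_transpose_left[of y C] y ..
  also have "y \<bullet> (M *v y) = x \<bullet> (\<Sigma> *v x) + y \<bullet> (V *v y)"
    unfolding quad y ..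
  finally show ?thesis
    using posterior_cov_quadratic_form[OF sym\<Sigma>, of C V x] M unfolding M_def[symmetric] w_def[symmetric]
    by simp
qed

lemma weighted_square_bound:
  fixes l s su cu e w k :: real
  assumes l: "0 < l" and s: "0 < s" and su: "0 < su" and ratio: "k^2 / s \<le> cu^2 / su"
  shows "su * l / (su + l * cu^2) * (e + k * w)^2 \<le> l * e^2 + s * w^2"
proof -
  define Q where "Q = l * e^2 + s * w^2"
  have "0 \<le> Q" using l s by (simp add: Q_def)
  have cauchy_schwarz: "l * s * (e + k * w)^2 \<le> (s + l * k^2) * Q"
  proof -
    have "(s + l * k^2) * Q - l * s * (e + k * w)^2 = (l * k * e - s * w)^2"
      by (simp add: Q_def power2_eq_square algebra_simps)
    then show ?thesis by (metis diff_ge_0_iff_ge zero_le_power2)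
  qed
  have "(s + l * k^2) * su \<le> s * (su + l * cu^2)"
    using ratio s su l by (simp add: field_simps)
  have "s * (su * l * (e + k * w)^2) = su * (l * s * (e + k * w)^2)" by (simp add: algebra_simps)
  also have "\<dots> \<le> su * ((s + l * k^2) * Q)" using cauchy_schwarz su by simp
  also have "\<dots> = ((s + l * k^2) * su) * Q" by (simp add: algebra_simps)
  also have "\<dots> \<le> (s * (su + l * cu^2)) * Q"
    using \<open>(s + l * k^2) * su \<le> s * (su + l * cu^2)\<close> \<open>0 \<le> Q\<close> by (rule mult_right_mono)
  finally have "s * (su * l * (e + k * w)^2) \<le> s * ((su + l * cu^2) * Q)" by (simp add: algebra_simps)
  then have "su * l * (e + k * w)^2 \<le> (su + l * cu^2) * Q" using s by simp
  moreover have "0 < su + l * cu^2" using l su by (simp add: add_pos_nonneg)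
  ultimately show ?thesis by (simp add: Q_def divide_le_eq mult.commute)
qed

lemma posterior_cov_diag_lower:
  fixes \<Sigma> C V :: "real^'n^'n" and \<sigma> :: "'n \<Rightarrow> real"
  assumes \<Sigma>: "pos_semidef \<Sigma>" and \<Sigma>_ge: "\<forall>y. lam * (y \<bullet> y) \<le> y \<bullet> (\<Sigma> *v y)" and lam: "0 < lam"
    and C: "diag_mat C" and V: "diag_mat V" "\<forall>i. V$i$i = (\<sigma> i)^2" and \<sigma>: "\<forall>i. 0 < \<sigma> i"
    and u_max: "\<forall>i. (C$i$i)^2 / (\<sigma> i)^2 \<le> (C$u$u)^2 / (\<sigma> u)^2"
  shows "(\<sigma> u)^2 * lam / ((\<sigma> u)^2 + lam * (C$u$u)^2) * (x \<bullet> x) \<le> x \<bullet> (posterior_cov \<Sigma> C V *v x)"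
proof -
  define \<kappa> where "\<kappa> = (\<sigma> u)^2 * lam / ((\<sigma> u)^2 + lam * (C$u$u)^2)"
  define w where "w = matrix_inv (C ** \<Sigma> ** transpose C + V) *v (C *v (\<Sigma> *v x))"
  define e where "e = x - C *v w"
  have "pos_def V" using V \<sigma> by (intro pos_def_diag_mat) (auto simp: less_le)
  have x_eq: "x$i = e$i + C$i$i * w$i" for i by (simp add: e_def diag_mat_mult_vec[OF C])
  have "\<kappa> * (x \<bullet> x) = (\<Sum>i\<in>UNIV. \<kappa> * (e$i + C$i$i * w$i)^2)"
    by (simp add: inner_vec_def x_eq power2_eq_square sum_distrib_left)
  also have "\<dots> \<le> (\<Sum>i\<in>UNIV. lam * (e$i)^2 + (\<sigma> i)^2 * (w$i)^2)"
    unfolding \<kappa>_def using \<sigma> u_max lam by (intro sum_mono weighted_square_bound) (auto simp: less_le)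
  also have "\<dots> = lam * (e \<bullet> e) + w \<bullet> (V *v w)"
    unfolding inner_diag_mat[OF V(1)]
    by (simp add: V(2) inner_vec_def power2_eq_square sum.distrib sum_distrib_left)
  also have "\<dots> \<le> e \<bullet> (\<Sigma> *v e) + w \<bullet> (V *v w)" using \<Sigma>_ge by simp
  also have "\<dots> = x \<bullet> (posterior_cov \<Sigma> C V *v x)"
  proof -
    have "invertible (C ** \<Sigma> ** transpose C + V)"
      using \<Sigma> \<open>pos_def V\<close> by (rule invertible_innovation_cov)
    then show ?thesis
      using \<Sigma> posterior_cov_joseph_form[of \<Sigma> C V x]
      unfolding e_def w_def diag_mat_transpose[OF C] by (simp add: pos_semidef_def)
  qed
  finally show ?thesis by (simp add: \<kappa>_def)
qed

lemma posterior_cov_diag_upper: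
  fixes \<Sigma> C V :: "real^'n^'n" and \<sigma> :: "'n \<Rightarrow> real"
  assumes \<Sigma>: "pos_semidef \<Sigma>"
    and C: "diag_mat C" "\<forall>i. C$i$i \<noteq> 0" and V: "diag_mat V" "\<forall>i. V$i$i = (\<sigma> i)^2"
    and \<sigma>: "\<forall>i. 0 < \<sigma> i"
    and l_min: "\<forall>i. (C$l$l)^2 / (\<sigma> l)^2 \<le> (C$i$i)^2 / (\<sigma> i)^2"
  shows "x \<bullet> (posterior_cov \<Sigma> C V *v x) \<le> (\<sigma> l)^2 / (C$l$l)^2 * (x \<bullet> x)"
proof -
  define y where "y = (\<chi> i. x$i / C$i$i)"
  have ratio: "(\<sigma> i)^2 / (C$i$i)^2 \<le> (\<sigma> l)^2 / (C$l$l)^2" for i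
  proof -
    have "0 < (C$l$l)^2 / (\<sigma> l)^2" using C(2) \<sigma> by (simp add: less_le)
    then have "inverse ((C$i$i)^2 / (\<sigma> i)^2) \<le> inverse ((C$l$l)^2 / (\<sigma> l)^2)"
      using l_min by (intro le_imp_inverse_le) auto
    then show ?thesis by (simp add: inverse_divide)
  qed
  have "pos_def V" using V \<sigma> by (intro pos_def_diag_mat) (auto simp: less_le)
  moreover have "transpose C *v y = x"
    using C by (simp add: diag_mat_transpose diag_mat_mult_vec y_def vec_eq_iff del: transpose_matrix_vector)
  ultimately have "x \<bullet> (posterior_cov \<Sigma> C V *v x) \<le> y \<bullet> (V *v y)"
    using posterior_cov_quadratic_le[OF \<Sigma>] by blast
  also have "\<dots> = (\<Sum>i\<in>UNIV. (\<sigma> i)^2 / (C$i$i)^2 * (x$i)^2)"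
    by (simp add: inner_diag_mat[OF V(1)] V(2) y_def power_divide)
  also have "\<dots> \<le> (\<Sum>i\<in>UNIV. (\<sigma> l)^2 / (C$l$l)^2 * (x$i)^2)"
    using ratio by (intro sum_mono mult_right_mono) auto
  also have "\<dots> = (\<sigma> l)^2 / (C$l$l)^2 * (x \<bullet> x)"
    by (simp add: inner_vec_def power2_eq_square sum_distrib_left)
  finally show ?thesis .
qed

lemma trace_congruence: "trace ((A::real^'n^'m) ** B ** transpose A) = (\<Sum>i\<in>UNIV. A$i \<bullet> (B *v A$i))"
  unfolding trace_def
  by (simp add: matrix_matrix_mult_def matrix_vector_mult_def inner_vec_def transpose_def
      sum_distrib_left sum_distrib_right mult.assoc mult.left_commute, subst sum.swap, simp)

lemma trace_transpose_mult_self: "trace (transpose (A::real^'n^'m) ** A) = (\<Sum>i\<in>UNIV. A$i \<bullet> A$i)"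
  unfolding trace_def
  by (simp add: matrix_matrix_mult_def inner_vec_def transpose_def, subst sum.swap, simp)

lemma trace_congruence_lower:
  assumes "\<forall>x. a * (x \<bullet> x) \<le> x \<bullet> (B *v x)"
  shows "a * trace (transpose (A::real^'n^'m) ** A) \<le> trace (A ** B ** transpose A)"
  using assms by (simp add: trace_congruence trace_transpose_mult_self sum_distrib_left sum_mono)

lemma trace_congruence_upper:
  assumes "\<forall>x. x \<bullet> (B *v x) \<le> b * (x \<bullet> x)"
  shows "trace ((A::real^'n^'m) ** B ** transpose A) \<le> b * trace (transpose A ** A)"
  using assms by (simp add: trace_congruence trace_transpose_mult_self sum_distrib_left sum_mono)

lemma lambda_min_le_quadratic_congruence_add:
  assumes P: "\<forall>x. 0 \<le> x \<bullet> (P *v x)" and W: "sym_mat W"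
  shows "lambda_min W * (y \<bullet> y) \<le> y \<bullet> (((H::real^'n^'m) ** P ** transpose H + W) *v y)"
proof -
  have "y \<bullet> ((H ** P ** transpose H + W) *v y)
      = (transpose H *v y) \<bullet> (P *v (transpose H *v y)) + y \<bullet> (W *v y)"
    by (simp add: matrix_vector_mult_add_rdistrib inner_add_right inner_congruence del: transpose_matrix_vector)
  then show ?thesis using P lambda_min_le_quadratic[OF W, of y] by (metis add_increasing)
qed

theorem theorem1:
  fixes H W \<Sigma> C V :: "real^'n^'n"
    and D :: "real^'m^'n"
    and \<sigma> :: "'n \<Rightarrow> real"
    and l u :: 'n
  assumes W_pd: "pos_def W"
    and C_diag: "diag_mat C" and C_nz: "\<forall>i. C$i$i \<noteq> 0"
    and V_diag: "diag_mat V" and V_entries: "\<forall>i. V$i$i = (\<sigma> i)^2" and sigma_pos: "\<forall>i. \<sigma> i > 0"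
    and W_fact: "W = D ** transpose D"
    and obs: "observable H C"
    and ctrb: "controllable H D"
    and Sigma_psd: "pos_semidef \<Sigma>"
    and DARE: "\<Sigma> = H ** \<Sigma> ** transpose H
                 - H ** \<Sigma> ** transpose C ** matrix_inv (C ** \<Sigma> ** transpose C + V) ** C ** \<Sigma> ** transpose H
                 + W"
    and l_min: "\<forall>i. (C$l$l)^2 / (\<sigma> l)^2 \<le> (C$i$i)^2 / (\<sigma> i)^2"
    and u_max: "\<forall>i. (C$i$i)^2 / (\<sigma> i)^2 \<le> (C$u$u)^2 / (\<sigma> u)^2"
  shows "trace W + (\<sigma> u)^2 * trace (transpose H ** H) * lambda_min W
            / ((\<sigma> u)^2 + lambda_min W * (C$u$u)^2) \<le> trace \<Sigma>
       \<and> trace \<Sigma> \<le> trace W + (\<sigma> l)^2 * trace (transpose H ** H) / (C$l$l)^2"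
proof -
  define P where "P = posterior_cov \<Sigma> C V"
  define lam where "lam = lambda_min W"
  have \<Sigma>_eq: "\<Sigma> = H ** P ** transpose H + W"
    using DARE by (simp add: P_def riccati_rhs_eq_posterior_cov)
  have "pos_def V" using V_diag V_entries sigma_pos by (intro pos_def_diag_mat) (auto simp: less_le)
  have "\<forall>x. 0 \<le> x \<bullet> (P *v x)"
    unfolding P_def using Sigma_psd \<open>pos_def V\<close> by (blast intro: posterior_cov_quadratic_nonneg)
  then have "\<forall>y. lam * (y \<bullet> y) \<le> y \<bullet> (\<Sigma> *v y)"
    using W_pd \<Sigma>_eq unfolding lam_def pos_def_def
    by (metis lambda_min_le_quadratic_congruence_add)
  then have "\<forall>x. (\<sigma> u)^2 * lam / ((\<sigma> u)^2 + lam * (C$u$u)^2) * (x \<bullet> x) \<le> x \<bullet> (P *v x)"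
    using lambda_min_pos[OF W_pd] Sigma_psd C_diag V_diag V_entries sigma_pos u_max
    unfolding P_def lam_def by (blast intro: posterior_cov_diag_lower)
  from trace_congruence_lower[OF this, of H]
  have lower: "(\<sigma> u)^2 * trace (transpose H ** H) * lam / ((\<sigma> u)^2 + lam * (C$u$u)^2)
               \<le> trace (H ** P ** transpose H)"
    by (simp add: mult_ac)
  have "\<forall>x. x \<bullet> (P *v x) \<le> (\<sigma> l)^2 / (C$l$l)^2 * (x \<bullet> x)"
    using Sigma_psd C_diag C_nz V_diag V_entries sigma_pos l_min
    unfolding P_def by (blast intro: posterior_cov_diag_upper)
  from trace_congruence_upper[OF this, of H]
  have upper: "trace (H ** P ** transpose H) \<le> (\<sigma> l)^2 * trace (transpose H ** H) / (C$l$l)^2"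
    by (simp add: mult_ac)
  have "trace \<Sigma> = trace W + trace (H ** P ** transpose H)"
    by (subst \<Sigma>_eq) (simp add: trace_add)
  then show ?thesis using lower upper unfolding lam_def by linarith
qed

end
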